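(* Let $H \le G$ be finite groups such that the interval $[H,G]$ is bottom Boolean. Then $[H,G]$ is linearly primitive, i.e. there is an irreducible complex representation $V$ of $G$ with $G_{(V^H)} = H$.
   Context: The interval $[H,G]$ is the lattice of subgroups $L$ with $H \le L \le G$ (meet = intersection, join = generated subgroup); its atoms are its minimal elements strictly above $H$; its bottom interval is $[H,B]$ with $B$ the join of all atoms. A finite lattice is Boolean if it is isomorphic to the lattice of all subsets of a finite set; $[H,G]$ is bottom Boolean if its bottom interval is Boolean. For a representation $V$ of $G$ and a subspace $X$: $V^H = \{v : hv = v \ \forall h \in H\}$ and $G_{(X)} = \{g \in G : gx = x \ \forall x \in X\}$. *)

theory Defs
  imports "HOL-Algebra.Algebra" "Jordan_Normal_Form.Matrix"
begin

definition sg_interval :: "('g, 'b) monoid_scheme \<Rightarrow> 'g set \<Rightarrow> 'g set set" where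
  "sg_interval G H = {L. subgroup L G \<and> H \<subseteq> L}"

definition sg_atoms :: "('g, 'b) monoid_scheme \<Rightarrow> 'g set \<Rightarrow> 'g set set" where
  "sg_atoms G H = {L \<in> sg_interval G H. H \<subset> L \<and>
      (\<forall>M \<in> sg_interval G H. H \<subset> M \<and> M \<subseteq> L \<longrightarrow> M = L)}"

text \<open>B: the join (in the interval) of all atoms; the join of the empty family is H.\<close>
definition sg_bottom_top :: "('g, 'b) monoid_scheme \<Rightarrow> 'g set \<Rightarrow> 'g set" where
  "sg_bottom_top G H = generate G (H \<union> \<Union>(sg_atoms G H))"

definition sg_bottom_interval :: "('g, 'b) monoid_scheme \<Rightarrow> 'g set \<Rightarrow> 'g set set" where
  "sg_bottom_interval G H = {L \<in> sg_interval G H. L \<subseteq> sg_bottom_top G H}"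

text \<open>A finite lattice of sets (ordered by inclusion) is Boolean if it is
isomorphic to the lattice of all subsets of a finite set. Any finite set is
in bijection with a finite set of naturals, so we use index sets of type nat set.
A lattice isomorphism is the same as an order isomorphism.\<close>
definition boolean_lattice :: "'a set set \<Rightarrow> bool" where
  "boolean_lattice Ls \<longleftrightarrow> (\<exists>I \<phi>. finite (I :: nat set) \<and> bij_betw \<phi> (Pow I) Ls \<and>
      (\<forall>S \<in> Pow I. \<forall>T \<in> Pow I. S \<subseteq> T \<longleftrightarrow> \<phi> S \<subseteq> \<phi> T))"

definition bottom_boolean :: "('g, 'b) monoid_scheme \<Rightarrow> 'g set \<Rightarrow> bool" where
  "bottom_boolean G H \<longleftrightarrow> boolean_lattice (sg_bottom_interval G H)"

definition is_rep :: "('g, 'b) monoid_scheme \<Rightarrow> nat \<Rightarrow> ('g \<Rightarrow> complex mat) \<Rightarrow> bool" where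
  "is_rep G n \<rho> \<longleftrightarrow>
     (\<forall>g \<in> carrier G. \<rho> g \<in> carrier_mat n n) \<and>
     \<rho> \<one>\<^bsub>G\<^esub> = 1\<^sub>m n \<and>
     (\<forall>g \<in> carrier G. \<forall>h \<in> carrier G. \<rho> (g \<otimes>\<^bsub>G\<^esub> h) = \<rho> g * \<rho> h)"

definition is_subspace_vec :: "nat \<Rightarrow> complex vec set \<Rightarrow> bool" where
  "is_subspace_vec n W \<longleftrightarrow> W \<subseteq> carrier_vec n \<and> 0\<^sub>v n \<in> W \<and>
     (\<forall>v \<in> W. \<forall>w \<in> W. v + w \<in> W) \<and> (\<forall>c. \<forall>v \<in> W. c \<cdot>\<^sub>v v \<in> W)"

definition invariant_subspace :: "('g, 'b) monoid_scheme \<Rightarrow> nat \<Rightarrow> ('g \<Rightarrow> complex mat) \<Rightarrow> complex vec set \<Rightarrow> bool" where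
  "invariant_subspace G n \<rho> W \<longleftrightarrow> is_subspace_vec n W \<and>
     (\<forall>g \<in> carrier G. \<forall>w \<in> W. \<rho> g *\<^sub>v w \<in> W)"

definition irreducible_rep :: "('g, 'b) monoid_scheme \<Rightarrow> nat \<Rightarrow> ('g \<Rightarrow> complex mat) \<Rightarrow> bool" where
  "irreducible_rep G n \<rho> \<longleftrightarrow> is_rep G n \<rho> \<and> n > 0 \<and>
     (\<forall>W. invariant_subspace G n \<rho> W \<longrightarrow> W = {0\<^sub>v n} \<or> W = carrier_vec n)"

definition fixed_space :: "nat \<Rightarrow> ('g \<Rightarrow> complex mat) \<Rightarrow> 'g set \<Rightarrow> complex vec set" where
  "fixed_space n \<rho> H = {v \<in> carrier_vec n. \<forall>h \<in> H. \<rho> h *\<^sub>v v = v}"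

definition pointwise_stab :: "('g, 'b) monoid_scheme \<Rightarrow> ('g \<Rightarrow> complex mat) \<Rightarrow> complex vec set \<Rightarrow> 'g set" where
  "pointwise_stab G \<rho> Y = {g \<in> carrier G. \<forall>x \<in> Y. \<rho> g *\<^sub>v x = x}"

end

theory Submission
  imports Defs "Jordan_Normal_Form.Determinant"
begin

text \<open>Write \<open>e(K)\<close> for the averaging idempotent of a subgroup \<open>K\<close> in the complex group algebra, and let
  \<open>A\<^sub>1, \<dots>, A\<^sub>m\<close> be the atoms of the interval. The product
  \<open>x = e(H) (e(H) - e(A\<^sub>1)) \<dots> (e(H) - e(A\<^sub>m))\<close> is nonzero: a partial product is supported on the join of
  the atoms used so far, and since that join does not contain the next atom, the partial product is
  not right invariant under it. Here it matters that in a Boolean lattice no atom lies below the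
  join of others. As \<open>y = x\<^sup>* x\<close> has a nonzero coefficient at the identity, the trace of \<open>y\<close> in the regular
  representation is nonzero. A representation of least dimension in which \<open>y\<close> has nonzero trace is
  irreducible, because the trace is additive on block triangular matrices. If the pointwise
  stabiliser of \<open>V\<^sup>H\<close> were larger than \<open>H\<close>, it would contain an atom \<open>A\<^sub>i\<close>, so \<open>e(H) - e(A\<^sub>i)\<close>, and with it
  \<open>y\<close>, would act as zero on \<open>V\<close>.\<close>

section \<open>A nonzero element of the group algebra\<close>

lemma (in group) sum_mult_right:
  assumes "a \<in> carrier G"
  shows "(\<Sum>g\<in>carrier G. f (g \<otimes> a)) = (\<Sum>g\<in>carrier G. f g)"
  by (rule sum.reindex_bij_witness[of _ "\<lambda>g. g \<otimes> inv a" "\<lambda>g. g \<otimes> a"])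
    (use assms in \<open>auto simp: m_assoc\<close>)

lemma (in group) sum_mult_left:
  assumes "a \<in> carrier G"
  shows "(\<Sum>g\<in>carrier G. f (a \<otimes> g)) = (\<Sum>g\<in>carrier G. f g)"
  by (rule sum.reindex_bij_witness[of _ "\<lambda>g. inv a \<otimes> g" "\<lambda>g. a \<otimes> g"])
    (use assms in \<open>auto simp: m_assoc[symmetric]\<close>)

lemma (in group) sum_subgroup_mult_left:
  assumes "subgroup K G" "a \<in> K"
  shows "(\<Sum>g\<in>K. f (a \<otimes> g)) = (\<Sum>g\<in>K. f g)"
proof -
  have K: "g \<in> carrier G" if "g \<in> K" for g
    using that assms(1) subgroup.mem_carrier by metis
  show ?thesis
    by (rule sum.reindex_bij_witness[of _ "\<lambda>g. inv a \<otimes> g" "\<lambda>g. a \<otimes> g"])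
      (use assms K subgroup.m_closed[OF assms(1)] subgroup.m_inv_closed[OF assms(1)]
        in \<open>auto simp: m_assoc[symmetric]\<close>)
qed

text \<open>Symmetry in products is the form of conjugation invariance that traces satisfy directly,
  and it lets a right factor of the argument be moved to the left.\<close>

definition class_function :: "('g, 'b) monoid_scheme \<Rightarrow> ('g \<Rightarrow> complex) \<Rightarrow> bool" where
  "class_function G \<chi> \<longleftrightarrow>
     (\<forall>g\<in>carrier G. \<forall>h\<in>carrier G. \<chi> (g \<otimes>\<^bsub>G\<^esub> h) = \<chi> (h \<otimes>\<^bsub>G\<^esub> g))"

text \<open>For the character of a representation \<open>V\<close>, this is implied by \<open>V\<^sup>H \<subseteq> V\<^sup>A\<close>.\<close>

definition absorbs :: "('g, 'b) monoid_scheme \<Rightarrow> 'g set \<Rightarrow> 'g set \<Rightarrow> ('g \<Rightarrow> complex) \<Rightarrow> bool" where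
  "absorbs G H A \<chi> \<longleftrightarrow> (\<forall>k\<in>carrier G. \<forall>a\<in>A.
     (\<Sum>h\<in>H. \<chi> (k \<otimes>\<^bsub>G\<^esub> a \<otimes>\<^bsub>G\<^esub> h)) = (\<Sum>h\<in>H. \<chi> (k \<otimes>\<^bsub>G\<^esub> h)))"

text \<open>Read \<open>x\<close> as the group algebra element with coefficients \<open>x g\<close>.
  If \<open>\<chi>\<close> is the character of \<open>V\<close>, the sum is the trace of
  \<open>k x\<close> on \<open>V\<close>, so the condition follows when \<open>x\<close> acts as
  zero on \<open>V\<close>. Using scalar functions keeps matrices out of this section.\<close>

definition annihilates :: "('g, 'b) monoid_scheme \<Rightarrow> ('g \<Rightarrow> complex) \<Rightarrow> ('g \<Rightarrow> complex) \<Rightarrow> bool" where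
  "annihilates G x \<chi> \<longleftrightarrow> (\<forall>k\<in>carrier G. (\<Sum>g\<in>carrier G. x g * \<chi> (k \<otimes>\<^bsub>G\<^esub> g)) = 0)"

text \<open>Up to a scalar, this is right multiplication by \<open>1 - e(A)\<close>, which agrees with \<open>e(H) - e(A)\<close> on
  right \<open>H\<close>-invariant elements.\<close>

definition mult_avg_diff :: "('g, 'b) monoid_scheme \<Rightarrow> 'g set \<Rightarrow> ('g \<Rightarrow> complex) \<Rightarrow> 'g \<Rightarrow> complex" where
  "mult_avg_diff G A x g = (\<Sum>a\<in>A. x g - x (g \<otimes>\<^bsub>G\<^esub> a))"

text \<open>Moves the averaging from \<open>x\<close> to the function paired with it: under the
  pairing, right translation by \<open>a\<close> is adjoint to right translation by
  \<open>inv a\<close>.\<close>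

lemma (in group) sum_mult_avg_diff:
  assumes "A \<subseteq> carrier G"
  shows "(\<Sum>g\<in>carrier G. mult_avg_diff G A x g * c g) =
    (\<Sum>a\<in>A. (\<Sum>g\<in>carrier G. x g * c g) - (\<Sum>g\<in>carrier G. x g * c (g \<otimes> inv a)))"
proof -
  have "(\<Sum>g\<in>carrier G. mult_avg_diff G A x g * c g) =
      (\<Sum>a\<in>A. \<Sum>g\<in>carrier G. x g * c g - x (g \<otimes> a) * c g)"
    unfolding mult_avg_diff_def
    by (subst sum.swap) (simp add: sum_distrib_right left_diff_distrib)
  also have "\<dots> = (\<Sum>a\<in>A. (\<Sum>g\<in>carrier G. x g * c g) -
      (\<Sum>g\<in>carrier G. x g * c (g \<otimes> inv a)))"
  proof (rule sum.cong[OF refl])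
    fix a assume "a \<in> A"
    with assms have a: "a \<in> carrier G" by blast
    have "(\<Sum>g\<in>carrier G. x (g \<otimes> a) * c g) =
        (\<Sum>g\<in>carrier G. x (g \<otimes> a) * c (g \<otimes> a \<otimes> inv a))"
      using a by (intro sum.cong) (auto simp: m_assoc)
    also have "\<dots> = (\<Sum>g\<in>carrier G. x g * c (g \<otimes> inv a))"
      by (rule sum_mult_right[OF a, of "\<lambda>g. x g * c (g \<otimes> inv a)"])
    finally show "(\<Sum>g\<in>carrier G. x g * c g - x (g \<otimes> a) * c g) =
      (\<Sum>g\<in>carrier G. x g * c g) - (\<Sum>g\<in>carrier G. x g * c (g \<otimes> inv a))"
      by (simp add: sum_subtractf)
  qed
  finally show ?thesis .
qed

text \<open>Later factors do not destroy annihilation: for a class function the right factor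
  \<open>inv a\<close> cycles to the left, where it is absorbed into the arbitrary
  \<open>k\<close>.\<close>

lemma (in group) annihilates_mult_avg_diff:
  assumes A: "A \<subseteq> carrier G" and \<chi>: "class_function G \<chi>" and x: "annihilates G x \<chi>"
  shows "annihilates G (mult_avg_diff G A x) \<chi>"
  unfolding annihilates_def
proof
  fix k assume k: "k \<in> carrier G"
  have "(\<Sum>g\<in>carrier G. x g * \<chi> (k \<otimes> (g \<otimes> inv a))) = 0" if "a \<in> A" for a
  proof -
    have a: "a \<in> carrier G" using that A by blast
    have "(\<Sum>g\<in>carrier G. x g * \<chi> (k \<otimes> (g \<otimes> inv a))) =
        (\<Sum>g\<in>carrier G. x g * \<chi> ((inv a \<otimes> k) \<otimes> g))"
    proof (intro sum.cong refl)
      fix g assume g: "g \<in> carrier G"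
      have "\<chi> (k \<otimes> g \<otimes> inv a) = \<chi> (inv a \<otimes> (k \<otimes> g))"
        using \<chi> a k g unfolding class_function_def by blast
      then show "x g * \<chi> (k \<otimes> (g \<otimes> inv a)) = x g * \<chi> ((inv a \<otimes> k) \<otimes> g)"
        using a k g by (simp add: m_assoc)
    qed
    also have "\<dots> = 0" using x a k unfolding annihilates_def by blast
    finally show ?thesis .
  qed
  moreover have "(\<Sum>g\<in>carrier G. x g * \<chi> (k \<otimes> g)) = 0"
    using x k unfolding annihilates_def by blast
  ultimately show "(\<Sum>g\<in>carrier G. mult_avg_diff G A x g * \<chi> (k \<otimes> g)) = 0"
    by (simp add: sum_mult_avg_diff[OF A, of x "\<lambda>g. \<chi> (k \<otimes> g)"])
qed

lemma (in group) mult_avg_diff_invariant: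
  assumes A: "subgroup A G" and "h \<in> A" "g \<in> carrier G" "x (g \<otimes> h) = x g"
  shows "mult_avg_diff G A x (g \<otimes> h) = mult_avg_diff G A x g"
proof -
  have A': "a \<in> carrier G" if "a \<in> A" for a using that A subgroup.mem_carrier by metis
  have "(\<Sum>a\<in>A. x g - x (g \<otimes> (h \<otimes> a))) = (\<Sum>a\<in>A. x g - x (g \<otimes> a))"
    by (rule sum_subgroup_mult_left[OF A \<open>h \<in> A\<close>, of "\<lambda>a. x g - x (g \<otimes> a)"])
  then show ?thesis using assms A' unfolding mult_avg_diff_def by (simp add: m_assoc)
qed

text \<open>The new element is right \<open>H\<close>-invariant, so up to the factor
  \<open>card H\<close> it may be paired with the \<open>H\<close>-sum \<open>c\<close> of
  \<open>\<chi>\<close>. Absorption makes \<open>c\<close> right \<open>A\<close>-invariant, and the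
  differences in \<open>sum_mult_avg_diff\<close> cancel.\<close>

lemma (in group) absorbs_imp_annihilates:
  assumes fin: "finite (carrier G)" and H: "subgroup H G" and A: "subgroup A G"
    and HA: "H \<subseteq> A" and x: "\<And>g h. g \<in> carrier G \<Longrightarrow> h \<in> H \<Longrightarrow> x (g \<otimes> h) = x g"
    and \<chi>: "absorbs G H A \<chi>"
  shows "annihilates G (mult_avg_diff G A x) \<chi>"
  unfolding annihilates_def
proof
  fix k assume k: "k \<in> carrier G"
  let ?y = "mult_avg_diff G A x"
  define c where "c g = (\<Sum>h\<in>H. \<chi> (k \<otimes> g \<otimes> h))" for g
  have Hc: "h \<in> carrier G" if "h \<in> H" for h using that H subgroup.mem_carrier by metis
  have Ac: "h \<in> carrier G" if "h \<in> A" for h using that A subgroup.mem_carrier by metis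
  have "H \<noteq> {}" "finite H"
    using subgroup.one_closed[OF H] Hc fin by (auto intro: finite_subset)
  \<comment> \<open>The factor \<open>card H\<close> provides one copy of the sum for each
    \<open>h\<close>; each copy is then translated by its own \<open>h\<close>.\<close>
  have "of_nat (card H) * (\<Sum>g\<in>carrier G. ?y g * \<chi> (k \<otimes> g)) =
      (\<Sum>h\<in>H. \<Sum>g\<in>carrier G. ?y g * \<chi> (k \<otimes> g))" by simp
  also have "\<dots> = (\<Sum>h\<in>H. \<Sum>g\<in>carrier G. ?y g * \<chi> (k \<otimes> g \<otimes> h))"
  proof (rule sum.cong[OF refl])
    fix h assume h: "h \<in> H"
    have "(\<Sum>g\<in>carrier G. ?y g * \<chi> (k \<otimes> g)) =
        (\<Sum>g\<in>carrier G. ?y (g \<otimes> h) * \<chi> (k \<otimes> (g \<otimes> h)))"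
      by (rule sum_mult_right[OF Hc[OF h], of "\<lambda>g. ?y g * \<chi> (k \<otimes> g)", symmetric])
    also have "\<dots> = (\<Sum>g\<in>carrier G. ?y g * \<chi> (k \<otimes> g \<otimes> h))"
      using h HA k Hc[OF h] x
      by (intro sum.cong) (auto simp: m_assoc mult_avg_diff_invariant[OF A])
    finally show "(\<Sum>g\<in>carrier G. ?y g * \<chi> (k \<otimes> g)) =
        (\<Sum>g\<in>carrier G. ?y g * \<chi> (k \<otimes> g \<otimes> h))" .
  qed
  also have "\<dots> = (\<Sum>g\<in>carrier G. ?y g * c g)"
    unfolding c_def by (subst sum.swap) (simp add: sum_distrib_left)
  also have "\<dots> = (\<Sum>a\<in>A. (\<Sum>g\<in>carrier G. x g * c g) - (\<Sum>g\<in>carrier G. x g * c (g \<otimes> inv a)))"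
    by (rule sum_mult_avg_diff) (use Ac in blast)
  also have "\<dots> = 0"
  proof (rule sum.neutral, rule ballI)
    fix a assume a: "a \<in> A"
    have "c (g \<otimes> inv a) = c g" if "g \<in> carrier G" for g
    proof -
      have "inv a \<in> A" using a A by (simp add: subgroup.m_inv_closed)
      then have "(\<Sum>h\<in>H. \<chi> (k \<otimes> g \<otimes> inv a \<otimes> h)) = (\<Sum>h\<in>H. \<chi> (k \<otimes> g \<otimes> h))"
        using \<chi> k that unfolding absorbs_def by blast
      then show ?thesis
        unfolding c_def using k that Ac[OF a] by (simp add: m_assoc)
    qed
    then show "(\<Sum>g\<in>carrier G. x g * c g) - (\<Sum>g\<in>carrier G. x g * c (g \<otimes> inv a)) = 0"
      by simp
  qed
  finally show "(\<Sum>g\<in>carrier G. ?y g * \<chi> (k \<otimes> g)) = 0"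
    using \<open>H \<noteq> {}\<close> \<open>finite H\<close> by simp
qed

text \<open>The factors are multiplied in one at a time by induction on \<open>S\<close>. Support in
  \<open>K S\<close> keeps the next product nonzero, and right \<open>H\<close>-invariance lets the
  next factor annihilate; both are therefore carried along. The Boolean structure enters through
  \<open>mono\<close> and \<open>notle\<close>.\<close>

lemma (in group) ex_annihilating_element:
  fixes K :: "'i set \<Rightarrow> 'a set"
  assumes fin: "finite (carrier G)" and H: "subgroup H G" and I: "finite I"
    and K: "\<And>S. S \<subseteq> I \<Longrightarrow> subgroup (K S) G \<and> H \<subseteq> K S"
    and mono: "\<And>S T. S \<subseteq> T \<Longrightarrow> T \<subseteq> I \<Longrightarrow> K S \<subseteq> K T"
    and notle: "\<And>S i. S \<subseteq> I \<Longrightarrow> i \<in> I \<Longrightarrow> i \<notin> S \<Longrightarrow> \<not> K {i} \<subseteq> K S"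
  shows "\<exists>x. (\<exists>g\<in>carrier G. x g \<noteq> 0) \<and>
    (\<forall>i\<in>I. \<forall>\<chi>. class_function G \<chi> \<and> absorbs G H (K {i}) \<chi> \<longrightarrow> annihilates G x \<chi>)"
proof -
  have "S \<subseteq> I \<Longrightarrow> \<exists>x. (\<exists>g\<in>carrier G. x g \<noteq> 0) \<and> (\<forall>g\<in>carrier G. g \<notin> K S \<longrightarrow> x g = 0) \<and>
      (\<forall>g\<in>carrier G. \<forall>h\<in>H. x (g \<otimes> h) = x g) \<and>
      (\<forall>i\<in>S. \<forall>\<chi>. class_function G \<chi> \<and> absorbs G H (K {i}) \<chi> \<longrightarrow> annihilates G x \<chi>)"
    if "finite S" for S
    using that
  proof (induction S rule: finite_induct)
    case empty
    have sg: "subgroup (K {}) G" and HK: "H \<subseteq> K {}" using K by auto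
    interpret sg: subgroup "K {}" G by (rule sg)
    have inv: "g \<otimes> h \<in> K {} \<longleftrightarrow> g \<in> K {}" if "g \<in> carrier G" "h \<in> H" for g h
    proof -
      have h: "h \<in> K {}" "h \<in> carrier G" using that HK by auto
      have "g \<in> K {}" if "g \<otimes> h \<in> K {}"
      proof -
        have "(g \<otimes> h) \<otimes> inv h \<in> K {}" using that h by blast
        then show ?thesis using \<open>g \<in> carrier G\<close> h by (simp add: m_assoc)
      qed
      then show ?thesis using h by blast
    qed
    \<comment> \<open>The start is the indicator function of \<open>K {}\<close>. In the application
      \<open>K {}\<close> is \<open>H\<close>, so this is a multiple of \<open>e(H)\<close>.\<close>
    show ?case
      by (rule exI[of _ "\<lambda>g. if g \<in> K {} then 1 else 0"]) (use inv sg.one_closed in \<open>auto intro!: bexI[of _ \<one>]\<close>)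
  next
    case (insert i S)
    then have SI: "S \<subseteq> I" "i \<in> I" "i \<notin> S" and iI: "{i} \<subseteq> I" by auto
    from insert.IH[OF SI(1)] obtain x where
      nz: "\<exists>g\<in>carrier G. x g \<noteq> 0" and supp: "\<And>g. g \<in> carrier G \<Longrightarrow> g \<notin> K S \<Longrightarrow> x g = 0" and
      xinv: "\<And>g h. g \<in> carrier G \<Longrightarrow> h \<in> H \<Longrightarrow> x (g \<otimes> h) = x g" and
      ann: "\<And>j \<chi>. j \<in> S \<Longrightarrow> class_function G \<chi> \<Longrightarrow> absorbs G H (K {j}) \<chi> \<Longrightarrow> annihilates G x \<chi>"
      by blast
    let ?A = "K {i}" and ?y = "mult_avg_diff G (K {i}) x"
    have A: "subgroup ?A G" and HA: "H \<subseteq> ?A" using K[OF iI] by auto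
    interpret A: subgroup ?A G by (rule A)
    interpret S: subgroup "K S" G using K[OF SI(1)] by blast
    interpret T: subgroup "K (insert i S)" G using K[OF insert.prems] by blast
    have AT: "?A \<subseteq> K (insert i S)" "K S \<subseteq> K (insert i S)"
      by (rule mono; use insert.prems in blast)+
    \<comment> \<open>If \<open>?y\<close> vanished, \<open>x\<close> would equal its own right
      average over \<open>?A\<close> and so be right \<open>?A\<close>-invariant. Translating a
      point \<open>g\<close> of the support by some \<open>a\<close> outside \<open>K S\<close>
      would then leave \<open>K S\<close> without leaving the support.\<close>
    have "\<exists>g\<in>carrier G. ?y g \<noteq> 0"
    proof (rule ccontr)
      assume "\<not> ?thesis"
      then have y0: "?y g = 0" if "g \<in> carrier G" for g using that by blast
      from nz obtain g where g: "g \<in> carrier G" "x g \<noteq> 0" by blast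
      then have gS: "g \<in> K S" using supp by blast
      obtain a where a: "a \<in> ?A" "a \<notin> K S" using notle[OF SI] by blast
      have finA: "finite ?A" using A.subset fin by (rule finite_subset)
      have avg: "of_nat (card ?A) * x u = (\<Sum>b\<in>?A. x (u \<otimes> b))" if "u \<in> carrier G" for u
        using y0[OF that] by (simp add: mult_avg_diff_def sum_subtractf)
      have "(\<Sum>b\<in>?A. x (g \<otimes> a \<otimes> b)) = (\<Sum>b\<in>?A. x (g \<otimes> b))"
        using sum_subgroup_mult_left[OF A a(1), of "\<lambda>b. x (g \<otimes> b)"] g a
        by (simp add: m_assoc)
      then have "of_nat (card ?A) * x (g \<otimes> a) = of_nat (card ?A) * x g"
        using avg g a by simp
      moreover have "card ?A \<noteq> 0" using finA a by auto
      ultimately have "x (g \<otimes> a) = x g" by simp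
      then have "g \<otimes> a \<in> K S" using g a supp[of "g \<otimes> a"] by fastforce
      then have "inv g \<otimes> (g \<otimes> a) \<in> K S" using gS by blast
      then show False using a g by (simp add: m_assoc[symmetric])
    qed
    moreover have "?y g = 0" if "g \<in> carrier G" "g \<notin> K (insert i S)" for g
      unfolding mult_avg_diff_def
    proof (rule sum.neutral, rule ballI)
      fix a assume a: "a \<in> ?A"
      have "g \<otimes> a \<notin> K (insert i S)"
      proof
        assume "g \<otimes> a \<in> K (insert i S)"
        moreover have "a \<in> K (insert i S)" using a AT by blast
        ultimately have "g \<otimes> a \<otimes> inv a \<in> K (insert i S)" by blast
        then show False using that a by (simp add: m_assoc)
      qed
      then have "g \<notin> K S" "g \<otimes> a \<notin> K S" using that AT by blast+
      then show "x g - x (g \<otimes> a) = 0" using that a supp[of g] supp[of "g \<otimes> a"] by simp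
    qed
    moreover have "?y (g \<otimes> h) = ?y g" if "g \<in> carrier G" "h \<in> H" for g h
      using mult_avg_diff_invariant[OF A] HA xinv that by blast
    moreover have "annihilates G ?y \<chi>"
      if "j \<in> insert i S" "class_function G \<chi>" "absorbs G H (K {j}) \<chi>" for j \<chi>
    proof (cases "j = i")
      case True
      then show ?thesis using absorbs_imp_annihilates[OF fin H A HA xinv] that by blast
    next
      case False
      then show ?thesis using annihilates_mult_avg_diff[OF A.subset] ann that by blast
    qed
    ultimately show ?case by blast
  qed
  from this[OF I] show ?thesis by blast
qed

text \<open>The witness is the product of \<open>x\<close> on the left with its adjoint, whose
  coefficient at \<open>g\<close> is \<open>cnj (x (inv g))\<close>. Its coefficient at the identity
  is the squared norm of \<open>x\<close>, and left multiplication preserves annihilation.\<close>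

lemma (in group) ex_annihilating_coefficients:
  assumes fin: "finite (carrier G)" and x: "\<exists>g\<in>carrier G. x g \<noteq> 0"
  shows "\<exists>y. y \<one> \<noteq> 0 \<and> (\<forall>\<chi>. annihilates G x \<chi> \<longrightarrow> (\<Sum>g\<in>carrier G. y g * \<chi> g) = 0)"
proof (intro exI conjI allI impI)
  let ?y = "\<lambda>g. \<Sum>k\<in>carrier G. cnj (x k) * x (k \<otimes> g)"
  have "?y \<one> = (\<Sum>k\<in>carrier G. complex_of_real ((cmod (x k))\<^sup>2))"
    by (intro sum.cong) (auto simp: complex_norm_square mult.commute simp del: of_real_power)
  also have "\<dots> = complex_of_real (\<Sum>k\<in>carrier G. (cmod (x k))\<^sup>2)" by simp
  also have "\<dots> \<noteq> 0"
    using x fin by (subst of_real_eq_0_iff, subst sum_nonneg_eq_0_iff) auto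
  finally show "?y \<one> \<noteq> 0" .
  fix \<chi> assume \<chi>: "annihilates G x \<chi>"
  have "(\<Sum>g\<in>carrier G. ?y g * \<chi> g) =
      (\<Sum>k\<in>carrier G. cnj (x k) * (\<Sum>g\<in>carrier G. x (k \<otimes> g) * \<chi> g))"
    by (subst sum_distrib_right, subst sum.swap) (simp add: sum_distrib_left mult.assoc)
  also have "\<dots> = 0"
  proof (rule sum.neutral, rule ballI)
    fix k assume k: "k \<in> carrier G"
    \<comment> \<open>Substituting \<open>g\<close> for \<open>k \<otimes> g\<close> gives the
      annihilation condition at \<open>inv k\<close>.\<close>
    have "(\<Sum>g\<in>carrier G. x (k \<otimes> g) * \<chi> g) =
        (\<Sum>g\<in>carrier G. x (k \<otimes> g) * \<chi> (inv k \<otimes> (k \<otimes> g)))"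
      using k by (intro sum.cong) (auto simp: m_assoc[symmetric])
    also have "\<dots> = (\<Sum>g\<in>carrier G. x g * \<chi> (inv k \<otimes> g))"
      by (rule sum_mult_left[OF k, of "\<lambda>g. x g * \<chi> (inv k \<otimes> g)"])
    also have "\<dots> = 0" using \<chi> k unfolding annihilates_def by blast
    finally show "cnj (x k) * (\<Sum>g\<in>carrier G. x (k \<otimes> g) * \<chi> g) = 0" by simp
  qed
  finally show "(\<Sum>g\<in>carrier G. ?y g * \<chi> g) = 0" .
qed

section \<open>Matrix representations and traces\<close>

definition mat_trace :: "complex mat \<Rightarrow> complex" where
  "mat_trace A = (\<Sum>i<dim_row A. A $$ (i, i))"

lemma mult_mat_entry:
  assumes "A \<in> carrier_mat m n" "B \<in> carrier_mat n k" "i < m" "j < k"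
  shows "(A * B) $$ (i, j) = (\<Sum>l<n. A $$ (i, l) * B $$ (l, j))"
  using assms by (auto simp: scalar_prod_def lessThan_atLeast0 intro!: sum.cong)

lemma mult_mat_vec_entry:
  assumes "A \<in> carrier_mat m n" "v \<in> carrier_vec n" "i < m"
  shows "(A *\<^sub>v v) $ i = (\<Sum>l<n. A $$ (i, l) * v $ l)"
  using assms by (auto simp: scalar_prod_def lessThan_atLeast0 intro!: sum.cong)

lemma mat_trace_mult_commute:
  assumes A: "A \<in> carrier_mat m n" and B: "B \<in> carrier_mat n m"
  shows "mat_trace (A * B) = mat_trace (B * A)"
proof -
  have "mat_trace (A * B) = (\<Sum>i<m. \<Sum>l<n. A $$ (i, l) * B $$ (l, i))"
    using A unfolding mat_trace_def by (auto simp: mult_mat_entry[OF A B] simp del: index_mult_mat(1))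
  also have "\<dots> = (\<Sum>l<n. \<Sum>i<m. B $$ (l, i) * A $$ (i, l))"
    by (subst sum.swap) (simp add: mult.commute)
  also have "\<dots> = mat_trace (B * A)"
    using B unfolding mat_trace_def by (auto simp: mult_mat_entry[OF B A] simp del: index_mult_mat(1))
  finally show ?thesis .
qed

lemma is_repD:
  assumes "is_rep G n \<rho>"
  shows "g \<in> carrier G \<Longrightarrow> \<rho> g \<in> carrier_mat n n" "\<rho> \<one>\<^bsub>G\<^esub> = 1\<^sub>m n"
    "g \<in> carrier G \<Longrightarrow> h \<in> carrier G \<Longrightarrow> \<rho> (g \<otimes>\<^bsub>G\<^esub> h) = \<rho> g * \<rho> h"
  using assms unfolding is_rep_def by blast+

lemma class_function_trace:
  assumes "is_rep G n \<rho>"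
  shows "class_function G (\<lambda>g. mat_trace (\<rho> g))"
  using is_repD[OF assms] mat_trace_mult_commute[of _ n n] unfolding class_function_def by simp

lemma is_rep_conjugate:
  assumes \<rho>: "is_rep G n \<rho>" and P: "P \<in> carrier_mat n n" and Q: "Q \<in> carrier_mat n n"
    and PQ: "P * Q = 1\<^sub>m n" and QP: "Q * P = 1\<^sub>m n"
  shows "is_rep G n (\<lambda>g. Q * (\<rho> g * P))"
    and "g \<in> carrier G \<Longrightarrow> mat_trace (Q * (\<rho> g * P)) = mat_trace (\<rho> g)"
proof -
  note r = is_repD[OF \<rho>]
  show "is_rep G n (\<lambda>g. Q * (\<rho> g * P))"
    unfolding is_rep_def
  proof (intro conjI ballI)
    show "Q * (\<rho> \<one>\<^bsub>G\<^esub> * P) = 1\<^sub>m n" using r(2) P QP by simp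
    fix g h assume g: "g \<in> carrier G" and h: "h \<in> carrier G"
    show "Q * (\<rho> g * P) \<in> carrier_mat n n" using Q P r(1)[OF g] by simp
    have "(Q * (\<rho> g * P)) * (Q * (\<rho> h * P)) = Q * (\<rho> g * ((P * Q) * (\<rho> h * P)))"
      using P Q r(1)[OF g] r(1)[OF h] by (simp add: assoc_mult_mat[of _ n n _ n _ n])
    also have "\<dots> = Q * (\<rho> (g \<otimes>\<^bsub>G\<^esub> h) * P)"
      using P Q PQ r(1)[OF g] r(1)[OF h] r(3)[OF g h]
      by (simp add: assoc_mult_mat[of _ n n _ n _ n])
    finally show "Q * (\<rho> (g \<otimes>\<^bsub>G\<^esub> h) * P) = (Q * (\<rho> g * P)) * (Q * (\<rho> h * P))" ..
  qed
  assume g: "g \<in> carrier G"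
  have "mat_trace (Q * (\<rho> g * P)) = mat_trace ((\<rho> g * P) * Q)"
    using Q P r(1)[OF g] by (intro mat_trace_mult_commute[of _ n n]) auto
  also have "(\<rho> g * P) * Q = \<rho> g"
    using Q P PQ r(1)[OF g] by (simp add: assoc_mult_mat[of _ n n _ n _ n])
  finally show "mat_trace (Q * (\<rho> g * P)) = mat_trace (\<rho> g)" .
qed

text \<open>By \<open>zero\<close>, indices outside \<open>T\<close> contribute nothing to the
  \<open>T\<close>-block of a product, so that block is multiplicative. Requiring only the product
  to vanish covers both diagonal blocks of a block triangular form: in one the left factor is zero,
  in the other the right factor.\<close>

lemma is_rep_diagonal_block:
  assumes \<rho>: "is_rep G n \<rho>" and T: "T \<subseteq> {..<n}"
    and zero: "\<And>g h i j l. g \<in> carrier G \<Longrightarrow> h \<in> carrier G \<Longrightarrow> i \<in> T \<Longrightarrow> j \<in> T \<Longrightarrow>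
      l \<in> {..<n} - T \<Longrightarrow> \<rho> g $$ (i, l) * \<rho> h $$ (l, j) = 0"
  shows "\<exists>\<sigma>. is_rep G (card T) \<sigma> \<and>
    (\<forall>g\<in>carrier G. mat_trace (\<sigma> g) = (\<Sum>i\<in>T. \<rho> g $$ (i, i)))"
proof -
  note r = is_repD[OF \<rho>]
  have "finite T" using T finite_subset by blast
  then obtain e where e: "bij_betw e {..<card T} T"
    using ex_bij_betw_nat_finite[of T] by (auto simp: lessThan_atLeast0)
  then have eT: "e i \<in> T" if "i < card T" for i using that by (auto simp: bij_betw_def)
  have en: "e i < n" if "i < card T" for i using eT[OF that] T by blast
  have ei: "e i = e j \<longleftrightarrow> i = j" if "i < card T" "j < card T" for i j
    using e that by (auto simp: bij_betw_def inj_on_def)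
  define \<sigma> where "\<sigma> g = mat (card T) (card T) (\<lambda>(i, j). \<rho> g $$ (e i, e j))" for g
  have dim: "\<sigma> g \<in> carrier_mat (card T) (card T)" for g unfolding \<sigma>_def by simp
  have "is_rep G (card T) \<sigma>"
    unfolding is_rep_def
  proof (intro conjI ballI dim)
    show "\<sigma> \<one>\<^bsub>G\<^esub> = 1\<^sub>m (card T)" by (rule eq_matI) (auto simp: \<sigma>_def r(2) en ei)
    fix g h assume g: "g \<in> carrier G" and h: "h \<in> carrier G"
    show "\<sigma> (g \<otimes>\<^bsub>G\<^esub> h) = \<sigma> g * \<sigma> h"
    proof (rule eq_matI)
      fix i j assume "i < dim_row (\<sigma> g * \<sigma> h)" "j < dim_col (\<sigma> g * \<sigma> h)"
      then have i: "i < card T" and j: "j < card T" using dim[of g] dim[of h] by auto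
      have "\<sigma> (g \<otimes>\<^bsub>G\<^esub> h) $$ (i, j) = (\<Sum>l<n. \<rho> g $$ (e i, l) * \<rho> h $$ (l, e j))"
        using i j en mult_mat_entry[OF r(1)[OF g] r(1)[OF h]] by (simp add: \<sigma>_def r(3)[OF g h])
      also have "\<dots> = (\<Sum>l\<in>T. \<rho> g $$ (e i, l) * \<rho> h $$ (l, e j))"
        using T zero[OF g h eT[OF i] eT[OF j]] by (intro sum.mono_neutral_right) auto
      also have "\<dots> = (\<Sum>l<card T. \<rho> g $$ (e i, e l) * \<rho> h $$ (e l, e j))"
        by (rule sum.reindex_bij_betw[OF e, symmetric])
      also have "\<dots> = (\<sigma> g * \<sigma> h) $$ (i, j)"
        using i j by (subst mult_mat_entry[OF dim dim]) (auto simp: \<sigma>_def)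
      finally show "\<sigma> (g \<otimes>\<^bsub>G\<^esub> h) $$ (i, j) = (\<sigma> g * \<sigma> h) $$ (i, j)" .
    qed (auto simp: \<sigma>_def)
  qed
  moreover have "mat_trace (\<sigma> g) = (\<Sum>i\<in>T. \<rho> g $$ (i, i))" for g
    unfolding sum.reindex_bij_betw[OF e, symmetric] by (simp add: mat_trace_def \<sigma>_def)
  ultimately show ?thesis by blast
qed

section \<open>Bases adapted to a subspace\<close>

lemma replace_column_identity_inverse:
  fixes c :: "nat \<Rightarrow> 'a :: field"
  assumes j: "j < n" and c: "c j \<noteq> 0"
  defines "E \<equiv> mat n n (\<lambda>(a, b). if b = j then c a else if a = b then 1 else 0)"
    and "F \<equiv> mat n n (\<lambda>(a, b). if b = j then (if a = j then 1 / c j else - c a / c j)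
      else if a = b then 1 else 0)"
  shows "E * F = 1\<^sub>m n" "F * E = 1\<^sub>m n"
proof -
  have dim: "E \<in> carrier_mat n n" "F \<in> carrier_mat n n" unfolding E_def F_def by auto
  show EF: "E * F = 1\<^sub>m n"
  proof (rule eq_matI)
    fix a b assume "a < dim_row (1\<^sub>m n :: 'a mat)" "b < dim_col (1\<^sub>m n :: 'a mat)"
    then have a: "a < n" and b: "b < n" by auto
    have "(E * F) $$ (a, b) = (\<Sum>l<n. E $$ (a, l) * F $$ (l, b))"
      using a b dim by (auto simp: scalar_prod_def lessThan_atLeast0 intro!: sum.cong)
    also have "\<dots> = E $$ (a, j) * F $$ (j, b) + (\<Sum>l\<in>{..<n} - {j}. E $$ (a, l) * F $$ (l, b))"
      using j by (intro sum.remove) auto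
    also have "(\<Sum>l\<in>{..<n} - {j}. E $$ (a, l) * F $$ (l, b)) =
        (\<Sum>l\<in>{..<n} - {j}. if l = a then F $$ (a, b) else 0)"
      using a by (intro sum.cong) (auto simp: E_def)
    also have "\<dots> = (if a = j then 0 else F $$ (a, b))" using a by simp
    finally show "(E * F) $$ (a, b) = 1\<^sub>m n $$ (a, b)"
      using a b j c by (auto simp: E_def F_def split: if_splits)
  qed (use dim in auto)
  show "F * E = 1\<^sub>m n" by (rule mat_mult_left_right_inverse[OF dim EF])
qed

text \<open>Steinitz exchange: take a basis, the columns of \<open>P\<close>, with as many members
  in \<open>W\<close> as possible. \<open>Q *\<^sub>v w\<close> is the coordinate vector of
  \<open>w\<close>. A nonzero coordinate of some \<open>w\<close> in \<open>W\<close> outside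
  \<open>S\<close> would allow a basis vector outside \<open>S\<close> to be exchanged for
  \<open>w\<close>, contradicting maximality.\<close>

lemma ex_adapted_basis:
  assumes W: "is_subspace_vec n W"
  shows "\<exists>P Q S. P \<in> carrier_mat n n \<and> Q \<in> carrier_mat n n \<and> P * Q = 1\<^sub>m n \<and> Q * P = 1\<^sub>m n \<and>
    S \<subseteq> {..<n} \<and> (\<forall>j\<in>S. col P j \<in> W) \<and> (\<forall>w\<in>W. \<forall>j\<in>{..<n} - S. (Q *\<^sub>v w) $ j = 0)"
proof -
  define ok where "ok P Q S \<longleftrightarrow> P \<in> carrier_mat n n \<and> Q \<in> carrier_mat n n \<and> P * Q = 1\<^sub>m n \<and>
    Q * P = 1\<^sub>m n \<and> S \<subseteq> {..<n} \<and> (\<forall>j\<in>S. col P j \<in> W)" for P Q :: "complex mat" and S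
  have ok0: "ok (1\<^sub>m n) (1\<^sub>m n) {}" unfolding ok_def by auto
  define R where "R k \<longleftrightarrow> (\<exists>P Q S. ok P Q S \<and> card S = k)" for k
  have "R 0" unfolding R_def by (intro exI conjI, rule ok0, simp)
  moreover have bound: "k \<le> n" if "R k" for k
  proof -
    from that obtain P Q S where "ok P Q S" "card S = k" unfolding R_def by (elim exE conjE)
    then show ?thesis using card_mono[of "{..<n}" S] by (simp add: ok_def)
  qed
  ultimately have "R (Greatest R)" by (rule GreatestI_nat)
  then have k: "\<exists>P Q S. ok P Q S \<and> card S = Greatest R" unfolding R_def .
  have max: "k' \<le> Greatest R" if "R k'" for k' using that bound by (rule Greatest_le_nat)
  from k obtain P Q S where ok: "ok P Q S" and S: "card S = Greatest R" by (elim exE conjE)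
  then have P: "P \<in> carrier_mat n n" and Q: "Q \<in> carrier_mat n n" and PQ: "P * Q = 1\<^sub>m n"
    and QP: "Q * P = 1\<^sub>m n" and Sn: "S \<subseteq> {..<n}" and SW: "\<And>j. j \<in> S \<Longrightarrow> col P j \<in> W"
    by (simp_all add: ok_def)
  have zero: "(Q *\<^sub>v w) $ j = 0" if w: "w \<in> W" and j: "j \<in> {..<n} - S" for w j
  proof (rule ccontr)
    assume c: "(Q *\<^sub>v w) $ j \<noteq> 0"
    have wn: "w \<in> carrier_vec n" using W w unfolding is_subspace_vec_def by blast
    \<comment> \<open>\<open>E\<close> is the identity with column \<open>j\<close> replaced by the
      coordinates of \<open>w\<close>, so \<open>P * E\<close> is \<open>P\<close> with column
      \<open>j\<close> replaced by \<open>w\<close>. \<open>F\<close> is its inverse, which exists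
      because the pivot \<open>(Q *\<^sub>v w) $ j\<close> is nonzero.\<close>
    define E F where
      "E = mat n n (\<lambda>(a, b). if b = j then (Q *\<^sub>v w) $ a else if a = b then 1 else 0)" and
      "F = mat n n (\<lambda>(a, b). if b = j then (if a = j then 1 / (Q *\<^sub>v w) $ j
        else - (Q *\<^sub>v w) $ a / (Q *\<^sub>v w) $ j) else if a = b then 1 else 0)"
    have dim: "E \<in> carrier_mat n n" "F \<in> carrier_mat n n" unfolding E_def F_def by auto
    have EF: "E * F = 1\<^sub>m n" "F * E = 1\<^sub>m n"
      using replace_column_identity_inverse[of j n "\<lambda>a. (Q *\<^sub>v w) $ a", OF _ c] j
      unfolding E_def F_def by auto
    have "(P * E) * (F * Q) = P * ((E * F) * Q)" "(F * Q) * (P * E) = F * ((Q * P) * E)"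
      using P Q dim by (simp_all add: assoc_mult_mat[of _ n n _ n _ n])
    then have inv: "(P * E) * (F * Q) = 1\<^sub>m n" "(F * Q) * (P * E) = 1\<^sub>m n"
      using P Q dim EF PQ QP by simp_all
    have "col (P * E) b \<in> W" if b: "b \<in> insert j S" for b
    proof -
      have bn: "b < n" using b j Sn by auto
      have colPE: "col (P * E) b = P *\<^sub>v col E b" using P dim bn by (intro col_mult2) auto
      show ?thesis
      proof (cases "b = j")
        case True
        have "col E b = Q *\<^sub>v w" using True bn Q by (intro eq_vecI) (auto simp: E_def)
        then have "col (P * E) b = (P * Q) *\<^sub>v w"
          using colPE P Q wn by (simp add: assoc_mult_mat_vec[of _ n n _ n])
        then show ?thesis using PQ wn w by simp
      next
        case False
        have "col E b = unit_vec n b" using False bn by (intro eq_vecI) (auto simp: E_def)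
        also have "\<dots> = col (1\<^sub>m n) b" using bn by simp
        finally have "col (P * E) b = col (P * 1\<^sub>m n) b"
          using colPE P bn by (subst col_mult2[OF P]) auto
        then show ?thesis using P SW False b by simp
      qed
    qed
    then have "ok (P * E) (F * Q) (insert j S)"
      unfolding ok_def using P Q dim inv Sn j by auto
    then have "card (insert j S) \<le> Greatest R" by (intro max) (auto simp: R_def)
    then show False using j Sn S finite_subset[OF Sn] by simp
  qed
  show ?thesis
    by (rule exI[of _ P], rule exI[of _ Q], rule exI[of _ S])
      (intro conjI ballI P Q PQ QP Sn SW zero)
qed

lemma mult_mat_vec_in_subspace:
  assumes W: "is_subspace_vec n W" and P: "P \<in> carrier_mat n n"
    and cols: "\<And>j. j < n \<Longrightarrow> col P j \<in> W" and u: "u \<in> carrier_vec n"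
  shows "P *\<^sub>v u \<in> W"
proof -
  \<comment> \<open>Partial sums of the combination of columns, so that closure of \<open>W\<close>
    is applied to one column at a time.\<close>
  have "vec n (\<lambda>i. \<Sum>l<k. P $$ (i, l) * u $ l) \<in> W" if "k \<le> n" for k
    using that
  proof (induction k)
    case 0
    have "vec n (\<lambda>i. \<Sum>l<(0::nat). P $$ (i, l) * u $ l) = 0\<^sub>v n" by auto
    then show ?case using W unfolding is_subspace_vec_def by simp
  next
    case (Suc k)
    have "vec n (\<lambda>i. \<Sum>l<Suc k. P $$ (i, l) * u $ l) =
        vec n (\<lambda>i. \<Sum>l<k. P $$ (i, l) * u $ l) + u $ k \<cdot>\<^sub>v col P k"
      using Suc.prems P by (intro eq_vecI) auto
    then show ?case
      using Suc cols[of k] W unfolding is_subspace_vec_def by simp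
  qed
  from this[of n] have "vec n (\<lambda>i. \<Sum>l<n. P $$ (i, l) * u $ l) \<in> W" by simp
  also have "vec n (\<lambda>i. \<Sum>l<n. P $$ (i, l) * u $ l) = P *\<^sub>v u"
    using P mult_mat_vec_entry[OF P u] by (intro eq_vecI) auto
  finally show ?thesis .
qed

text \<open>A representation is block triangular with respect to a basis adapted to an invariant
  subspace; the two diagonal blocks are again representations.\<close>

lemma reducible_trace_split:
  assumes \<rho>: "is_rep G n \<rho>" and inv: "invariant_subspace G n \<rho> W"
    and nz: "W \<noteq> {0\<^sub>v n}" and nn: "W \<noteq> carrier_vec n"
  shows "\<exists>m1 m2 \<sigma>1 \<sigma>2. m1 < n \<and> m2 < n \<and> is_rep G m1 \<sigma>1 \<and> is_rep G m2 \<sigma>2 \<and>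
    (\<forall>g\<in>carrier G. mat_trace (\<rho> g) = mat_trace (\<sigma>1 g) + mat_trace (\<sigma>2 g))"
proof -
  have W: "is_subspace_vec n W" using inv unfolding invariant_subspace_def by blast
  then have Wn: "W \<subseteq> carrier_vec n" and W0: "0\<^sub>v n \<in> W" unfolding is_subspace_vec_def by auto
  obtain P Q S where P: "P \<in> carrier_mat n n" and Q: "Q \<in> carrier_mat n n"
    and PQ: "P * Q = 1\<^sub>m n" and QP: "Q * P = 1\<^sub>m n" and S: "S \<subseteq> {..<n}"
    and SW': "\<forall>j\<in>S. col P j \<in> W"
    and WS': "\<forall>w\<in>W. \<forall>j\<in>{..<n} - S. (Q *\<^sub>v w) $ j = 0"
    using ex_adapted_basis[OF W] by (elim exE conjE)
  note SW = bspec[OF SW'] and WS = bspec[OF bspec[OF WS']]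
  have PQv: "P *\<^sub>v (Q *\<^sub>v v) = v" if "v \<in> carrier_vec n" for v
    using that P Q PQ by (simp flip: assoc_mult_mat_vec[of _ n n _ n])
  \<comment> \<open>With \<open>S\<close> empty all coordinates of vectors in \<open>W\<close>
    vanish; with \<open>S\<close> full all basis vectors lie in \<open>W\<close>. Excluding both
    cases makes both blocks smaller than \<open>n\<close>.\<close>
  have "S \<noteq> {}"
  proof
    assume S0: "S = {}"
    have "w = 0\<^sub>v n" if "w \<in> W" for w
    proof -
      have "Q *\<^sub>v w = 0\<^sub>v n" using WS[OF that] S0 Q by (intro eq_vecI) auto
      moreover have "P *\<^sub>v 0\<^sub>v n = 0\<^sub>v n" using P by auto
      ultimately show ?thesis using PQv[of w] that Wn by auto
    qed
    then have "W = {0\<^sub>v n}" using W0 by blast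
    then show False using nz by blast
  qed
  have "S \<noteq> {..<n}"
  proof
    assume "S = {..<n}"
    then have "v \<in> W" if "v \<in> carrier_vec n" for v
      using mult_mat_vec_in_subspace[OF W P, of "Q *\<^sub>v v"] SW PQv[OF that] Q that by auto
    then show False using nn Wn by blast
  qed
  define \<tau> where "\<tau> g = Q * (\<rho> g * P)" for g
  have \<tau>: "is_rep G n \<tau>" and tr: "\<And>g. g \<in> carrier G \<Longrightarrow> mat_trace (\<tau> g) = mat_trace (\<rho> g)"
    unfolding \<tau>_def using is_rep_conjugate[OF \<rho> P Q PQ QP] by blast+
  \<comment> \<open>Column \<open>j\<close> of \<open>P\<close> lies in \<open>W\<close>, hence so
    does its image under \<open>\<rho> g\<close>, whose coordinates outside \<open>S\<close>
    therefore vanish.\<close>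
  have zero: "\<tau> g $$ (i, j) = 0" if "g \<in> carrier G" "j \<in> S" "i \<in> {..<n} - S" for g i j
  proof -
    note rg = is_repD(1)[OF \<rho> that(1)]
    have ij: "i < n" "j < n" using that S by auto
    have "\<tau> g $$ (i, j) = col (\<tau> g) j $ i"
      using ij is_repD(1)[OF \<tau> that(1)] by simp
    also have "col (\<tau> g) j = Q *\<^sub>v col (\<rho> g * P) j"
      unfolding \<tau>_def using Q rg P ij by (intro col_mult2[of _ n n _ n]) auto
    also have "col (\<rho> g * P) j = \<rho> g *\<^sub>v col P j"
      using rg P ij by (intro col_mult2[of _ n n _ n]) auto
    finally show ?thesis
      using WS[of "\<rho> g *\<^sub>v col P j" i] inv SW that unfolding invariant_subspace_def by simp
  qed
  have "\<exists>\<sigma>. is_rep G (card S) \<sigma> \<and>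
      (\<forall>g\<in>carrier G. mat_trace (\<sigma> g) = (\<Sum>i\<in>S. \<tau> g $$ (i, i)))"
    using zero by (intro is_rep_diagonal_block[OF \<tau> S]) simp
  then obtain \<sigma>1 where 1: "is_rep G (card S) \<sigma>1"
      "\<And>g. g \<in> carrier G \<Longrightarrow> mat_trace (\<sigma>1 g) = (\<Sum>i\<in>S. \<tau> g $$ (i, i))" by blast
  have "\<exists>\<sigma>. is_rep G (card ({..<n} - S)) \<sigma> \<and>
      (\<forall>g\<in>carrier G. mat_trace (\<sigma> g) = (\<Sum>i\<in>{..<n} - S. \<tau> g $$ (i, i)))"
    using zero by (intro is_rep_diagonal_block[OF \<tau>]) auto
  then obtain \<sigma>2 where 2: "is_rep G (card ({..<n} - S)) \<sigma>2"
      "\<And>g. g \<in> carrier G \<Longrightarrow> mat_trace (\<sigma>2 g) = (\<Sum>i\<in>{..<n} - S. \<tau> g $$ (i, i))" by blast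
  have "mat_trace (\<rho> g) = mat_trace (\<sigma>1 g) + mat_trace (\<sigma>2 g)" if g: "g \<in> carrier G" for g
  proof -
    have "mat_trace (\<rho> g) = (\<Sum>i<n. \<tau> g $$ (i, i))"
      using is_repD(1)[OF \<tau> g] tr[OF g] by (simp add: mat_trace_def)
    also have "\<dots> = mat_trace (\<sigma>2 g) + mat_trace (\<sigma>1 g)"
      unfolding 1(2)[OF g] 2(2)[OF g] by (rule sum.subset_diff[OF S]) simp
    finally show ?thesis by simp
  qed
  moreover have "card S < n"
    using S \<open>S \<noteq> {..<n}\<close> psubset_card_mono[of "{..<n}" S] by auto
  moreover have "card ({..<n} - S) < n"
    using S \<open>S \<noteq> {}\<close> psubset_card_mono[of "{..<n}" "{..<n} - S"] by auto
  ultimately show ?thesis using 1(1) 2(1) by blast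
qed

section \<open>The regular representation and an irreducible representation of least
  dimension\<close>

lemma ex_regular_rep:
  fixes G (structure)
  assumes G: "group G" and fin: "finite (carrier G)"
  shows "\<exists>\<rho>. is_rep G (card (carrier G)) \<rho> \<and> (\<forall>g\<in>carrier G.
    mat_trace (\<rho> g) = (if g = \<one>\<^bsub>G\<^esub> then of_nat (card (carrier G)) else 0))"
proof -
  interpret group G by (rule G)
  let ?N = "card (carrier G)"
  obtain e where e: "bij_betw e {..<?N} (carrier G)"
    using ex_bij_betw_nat_finite[OF fin] by (auto simp: lessThan_atLeast0)
  then have eG: "e i \<in> carrier G" if "i < ?N" for i using that by (auto simp: bij_betw_def)
  have ei: "e i = e j \<longleftrightarrow> i = j" if "i < ?N" "j < ?N" for i j
    using e that by (auto simp: bij_betw_def inj_on_def)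
  \<comment> \<open>Permutation matrices of left multiplication, with the group elements numbered by
    \<open>e\<close>.\<close>
  define \<rho> :: "'a \<Rightarrow> complex mat" where
    "\<rho> g = mat ?N ?N (\<lambda>(i, j). if e i = g \<otimes> e j then 1 else 0)" for g
  have dim: "\<rho> g \<in> carrier_mat ?N ?N" for g unfolding \<rho>_def by simp
  have "is_rep G ?N \<rho>"
    unfolding is_rep_def
  proof (intro conjI ballI dim)
    show "\<rho> \<one> = 1\<^sub>m ?N" by (rule eq_matI) (auto simp: \<rho>_def eG ei)
    fix g h assume g: "g \<in> carrier G" and h: "h \<in> carrier G"
    show "\<rho> (g \<otimes> h) = \<rho> g * \<rho> h"
    proof (rule eq_matI)
      fix i j assume "i < dim_row (\<rho> g * \<rho> h)" "j < dim_col (\<rho> g * \<rho> h)"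
      then have i: "i < ?N" and j: "j < ?N" using dim[of g] dim[of h] by auto
      have "(\<rho> g * \<rho> h) $$ (i, j) = (\<Sum>l<?N. \<rho> g $$ (i, l) * \<rho> h $$ (l, j))"
        by (rule mult_mat_entry[OF dim dim i j])
      also have "\<dots> = (\<Sum>l<?N. (if e i = g \<otimes> e l then 1 else 0) * (if e l = h \<otimes> e j then 1 else 0))"
        using i j by (simp add: \<rho>_def)
      also have "\<dots> = (\<Sum>u\<in>carrier G. (if e i = g \<otimes> u then 1 else 0) * (if u = h \<otimes> e j then 1 else 0))"
        by (rule sum.reindex_bij_betw[OF e])
      also have "\<dots> = (\<Sum>u\<in>carrier G. if u = h \<otimes> e j then (if e i = g \<otimes> u then 1 else 0) else 0)"
        by (intro sum.cong) auto
      also have "\<dots> = \<rho> (g \<otimes> h) $$ (i, j)"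
        using fin i j g h eG[OF j] by (simp add: \<rho>_def m_assoc)
      finally show "\<rho> (g \<otimes> h) $$ (i, j) = (\<rho> g * \<rho> h) $$ (i, j)" ..
    qed (auto simp: \<rho>_def)
  qed
  moreover have "mat_trace (\<rho> g) = (if g = \<one> then of_nat ?N else 0)" if g: "g \<in> carrier G" for g
  proof -
    \<comment> \<open>The trace counts the fixed points of left multiplication by \<open>g\<close>;
      by cancellation only the identity has any.\<close>
    have "e i = g \<otimes> e i \<longleftrightarrow> g = \<one>" if "i < ?N" for i
      using g eG[OF that] by (metis l_one one_closed r_cancel)
    then show ?thesis unfolding mat_trace_def by (simp add: \<rho>_def)
  qed
  ultimately show ?thesis by blast
qed

lemma ex_irreducible_rep_trace:
  fixes G (structure)
  assumes G: "group G" and fin: "finite (carrier G)" and y: "y \<one>\<^bsub>G\<^esub> \<noteq> 0"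
  shows "\<exists>n \<rho>. irreducible_rep G n \<rho> \<and> (\<Sum>g\<in>carrier G. y g * mat_trace (\<rho> g)) \<noteq> 0"
proof -
  interpret group G by (rule G)
  define good where "good n \<longleftrightarrow>
    (\<exists>\<rho>. is_rep G n \<rho> \<and> (\<Sum>g\<in>carrier G. y g * mat_trace (\<rho> g)) \<noteq> 0)" for n
  obtain \<rho> where \<rho>: "is_rep G (card (carrier G)) \<rho>"
    and tr: "\<And>g. g \<in> carrier G \<Longrightarrow>
      mat_trace (\<rho> g) = (if g = \<one> then of_nat (card (carrier G)) else 0)"
    using ex_regular_rep[OF G fin] by blast
  \<comment> \<open>In the regular representation only the identity coefficient of \<open>y\<close>
    survives.\<close>
  have "(\<Sum>g\<in>carrier G. y g * mat_trace (\<rho> g)) =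
      (\<Sum>g\<in>carrier G. if g = \<one> then y \<one> * of_nat (card (carrier G)) else 0)"
    by (intro sum.cong) (auto simp: tr)
  also have "\<dots> = y \<one> * of_nat (card (carrier G))" using fin by simp
  also have "\<dots> \<noteq> 0" using y fin one_closed by (auto simp: card_eq_0_iff)
  finally have "good (card (carrier G))" using \<rho> unfolding good_def by blast
  then obtain n where n: "good n" and min: "\<And>m. m < n \<Longrightarrow> \<not> good m"
    using exists_least_iff[of good] by blast
  from n obtain \<rho> where \<rho>: "is_rep G n \<rho>" and nz: "(\<Sum>g\<in>carrier G. y g * mat_trace (\<rho> g)) \<noteq> 0"
    unfolding good_def by blast
  have "n \<noteq> 0"
  proof
    assume "n = 0"
    then have "mat_trace (\<rho> g) = 0" if "g \<in> carrier G" for g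
      using is_repD(1)[OF \<rho> that] by (simp add: mat_trace_def)
    then show False using nz by simp
  qed
  moreover have "W = {0\<^sub>v n} \<or> W = carrier_vec n" if inv: "invariant_subspace G n \<rho> W" for W
  proof (rule ccontr)
    assume "\<not> ?thesis"
    then obtain m1 m2 \<sigma>1 \<sigma>2 where m: "m1 < n" "m2 < n"
      and \<sigma>: "is_rep G m1 \<sigma>1" "is_rep G m2 \<sigma>2"
      and tr: "\<And>g. g \<in> carrier G \<Longrightarrow> mat_trace (\<rho> g) = mat_trace (\<sigma>1 g) + mat_trace (\<sigma>2 g)"
      using reducible_trace_split[OF \<rho> inv] by blast
    have "(\<Sum>g\<in>carrier G. y g * mat_trace (\<sigma>1 g)) = 0"
        "(\<Sum>g\<in>carrier G. y g * mat_trace (\<sigma>2 g)) = 0"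
      using min[OF m(1)] min[OF m(2)] \<sigma> unfolding good_def by blast+
    then show False using nz by (simp add: tr distrib_left sum.distrib)
  qed
  ultimately have "irreducible_rep G n \<rho>" using \<rho> unfolding irreducible_rep_def by blast
  then show ?thesis using nz by blast
qed

section \<open>Fixed vectors\<close>

text \<open>The columns of the sum of all \<open>\<rho> h\<close> with \<open>h\<close> in
  \<open>H\<close> are \<open>H\<close>-fixed, hence fixed by \<open>a\<close>. So
  \<open>\<rho> a\<close> times this sum is the sum itself; multiplying by \<open>\<rho> k\<close>
  and taking traces gives the claim.\<close>

lemma fixed_space_absorbs:
  fixes G (structure)
  assumes G: "group G" and H: "subgroup H G"
    and A: "A \<subseteq> pointwise_stab G \<rho> (fixed_space n \<rho> H)" and \<rho>: "is_rep G n \<rho>"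
  shows "absorbs G H A (\<lambda>g. mat_trace (\<rho> g))"
  unfolding absorbs_def
proof (intro ballI)
  interpret group G by (rule G)
  note r = is_repD[OF \<rho>]
  fix k a assume k: "k \<in> carrier G" and "a \<in> A"
  then have a: "a \<in> carrier G"
    and fix_a: "\<And>v. v \<in> fixed_space n \<rho> H \<Longrightarrow> \<rho> a *\<^sub>v v = v"
    using A unfolding pointwise_stab_def by auto
  have Hc: "h \<in> carrier G" if "h \<in> H" for h using that H subgroup.mem_carrier by metis
  have translate: "(\<rho> g *\<^sub>v vec n (\<lambda>i. \<Sum>h\<in>H. \<rho> h $$ (i, j))) $ i = (\<Sum>h\<in>H. \<rho> (g \<otimes> h) $$ (i, j))"
    if "g \<in> carrier G" "i < n" "j < n" for g i j
  proof -
    have "(\<rho> g *\<^sub>v vec n (\<lambda>i. \<Sum>h\<in>H. \<rho> h $$ (i, j))) $ i =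
        (\<Sum>l<n. \<rho> g $$ (i, l) * (\<Sum>h\<in>H. \<rho> h $$ (l, j)))"
      using that by (subst mult_mat_vec_entry[OF r(1)[OF that(1)]]) auto
    also have "\<dots> = (\<Sum>h\<in>H. \<Sum>l<n. \<rho> g $$ (i, l) * \<rho> h $$ (l, j))"
      by (subst sum.swap) (simp add: sum_distrib_left)
    also have "\<dots> = (\<Sum>h\<in>H. \<rho> (g \<otimes> h) $$ (i, j))"
      using that Hc by (intro sum.cong refl)
        (simp add: r(3) mult_mat_entry[OF r(1) r(1)] del: index_mult_mat(1))
    finally show ?thesis .
  qed
  have "vec n (\<lambda>i. \<Sum>h\<in>H. \<rho> h $$ (i, j)) \<in> fixed_space n \<rho> H" if j: "j < n" for j
    unfolding fixed_space_def
  proof (intro CollectI conjI ballI)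
    fix h assume h: "h \<in> H"
    show "\<rho> h *\<^sub>v vec n (\<lambda>i. \<Sum>h\<in>H. \<rho> h $$ (i, j)) = vec n (\<lambda>i. \<Sum>h\<in>H. \<rho> h $$ (i, j))"
    proof (rule eq_vecI)
      fix i assume "i < dim_vec (vec n (\<lambda>i. \<Sum>h\<in>H. \<rho> h $$ (i, j)))"
      then have i: "i < n" by simp
      show "(\<rho> h *\<^sub>v vec n (\<lambda>i. \<Sum>h\<in>H. \<rho> h $$ (i, j))) $ i = vec n (\<lambda>i. \<Sum>h\<in>H. \<rho> h $$ (i, j)) $ i"
        using translate[OF Hc[OF h] i j] i sum_subgroup_mult_left[OF H h, of "\<lambda>g. \<rho> g $$ (i, j)"]
        by simp
    qed (use r(1)[OF Hc[OF h]] in auto)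
  qed simp
  then have E: "(\<Sum>h\<in>H. \<rho> (a \<otimes> h) $$ (i, j)) = (\<Sum>h\<in>H. \<rho> h $$ (i, j))" if "i < n" "j < n" for i j
    using translate[OF a that] fix_a that by simp
  \<comment> \<open>A general \<open>f\<close> serves both sides of the claim, with
    \<open>f h\<close> equal to \<open>a \<otimes> h\<close> and to \<open>h\<close>.\<close>
  have tr: "(\<Sum>h\<in>H. mat_trace (\<rho> (k \<otimes> f h))) =
      (\<Sum>i<n. \<Sum>l<n. \<rho> k $$ (i, l) * (\<Sum>h\<in>H. \<rho> (f h) $$ (l, i)))"
    if f: "\<And>h. h \<in> H \<Longrightarrow> f h \<in> carrier G" for f
  proof -
    have "mat_trace (\<rho> (k \<otimes> f h)) = (\<Sum>i<n. \<Sum>l<n. \<rho> k $$ (i, l) * \<rho> (f h) $$ (l, i))"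
      if "h \<in> H" for h
      using r(1)[OF k] r(1)[OF f[OF that]] unfolding r(3)[OF k f[OF that]] mat_trace_def
      by (simp add: mult_mat_entry[of _ n n _ n] del: index_mult_mat(1))
    then have "(\<Sum>h\<in>H. mat_trace (\<rho> (k \<otimes> f h))) =
        (\<Sum>h\<in>H. \<Sum>i<n. \<Sum>l<n. \<rho> k $$ (i, l) * \<rho> (f h) $$ (l, i))" by simp
    also have "\<dots> = (\<Sum>i<n. \<Sum>l<n. \<Sum>h\<in>H. \<rho> k $$ (i, l) * \<rho> (f h) $$ (l, i))"
      by (subst sum.swap, intro sum.cong refl, rule sum.swap)
    finally show ?thesis by (simp add: sum_distrib_left)
  qed
  have "(\<Sum>h\<in>H. mat_trace (\<rho> (k \<otimes> (a \<otimes> h)))) = (\<Sum>h\<in>H. mat_trace (\<rho> (k \<otimes> h)))"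
    using tr[of "\<lambda>h. a \<otimes> h"] tr[of "\<lambda>h. h"] a Hc E by simp
  then show "(\<Sum>h\<in>H. mat_trace (\<rho> (k \<otimes> a \<otimes> h))) = (\<Sum>h\<in>H. mat_trace (\<rho> (k \<otimes> h)))"
    using a k Hc by (simp add: m_assoc)
qed

lemma subgroup_pointwise_stab:
  fixes G (structure)
  assumes G: "group G" and \<rho>: "is_rep G n \<rho>" and Y: "Y \<subseteq> carrier_vec n"
  shows "subgroup (pointwise_stab G \<rho> Y) G"
proof -
  interpret group G by (rule G)
  note r = is_repD[OF \<rho>]
  have mult: "\<rho> (g \<otimes> h) *\<^sub>v v = \<rho> g *\<^sub>v (\<rho> h *\<^sub>v v)"
    if "g \<in> carrier G" "h \<in> carrier G" "v \<in> Y" for g h v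
    using that Y by (auto simp: r(3) intro!: assoc_mult_mat_vec r(1))
  have one: "\<rho> \<one> *\<^sub>v v = v" if "v \<in> Y" for v using that Y r(2) by auto
  show ?thesis
  proof (rule subgroupI)
    show "pointwise_stab G \<rho> Y \<noteq> {}" using one unfolding pointwise_stab_def by blast
    fix g assume g: "g \<in> pointwise_stab G \<rho> Y"
    then have gc: "g \<in> carrier G" unfolding pointwise_stab_def by blast
    have "\<rho> (inv g) *\<^sub>v v = v" if "v \<in> Y" for v
      using mult[of "inv g" g v] one[OF that] that gc g unfolding pointwise_stab_def by simp
    then show "inv g \<in> pointwise_stab G \<rho> Y" using gc unfolding pointwise_stab_def by simp
    fix h assume "h \<in> pointwise_stab G \<rho> Y"
    then show "g \<otimes> h \<in> pointwise_stab G \<rho> Y"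
      using g mult unfolding pointwise_stab_def by simp
  qed (auto simp: pointwise_stab_def)
qed

section \<open>Atoms and the pointwise stabiliser\<close>

lemma ex_atom_le:
  assumes fin: "finite (carrier G)" and L: "subgroup L G" "H \<subset> L"
  shows "\<exists>A\<in>sg_atoms G H. A \<subseteq> L"
proof -
  define C where "C = {M \<in> sg_interval G H. H \<subset> M \<and> M \<subseteq> L}"
  have "C \<subseteq> Pow (carrier G)"
    unfolding C_def sg_interval_def using subgroup.subset by blast
  then have "finite C" using fin finite_subset by blast
  moreover have "L \<in> C" using L unfolding C_def sg_interval_def by auto
  ultimately obtain A where A: "A \<in> C" and min: "\<forall>M\<in>C. M \<subseteq> A \<longrightarrow> A = M"
    using finite_has_minimal2[of C L] by blast
  then have "A \<in> sg_atoms G H" unfolding C_def sg_atoms_def by auto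
  then show ?thesis using A unfolding C_def by blast
qed

theorem theorem3p13:
  fixes G :: "('g, 'b) monoid_scheme" and H :: "'g set"
  assumes "group G" and "finite (carrier G)" and "subgroup H G"
    and "bottom_boolean G H"
  shows "\<exists>n \<rho>. irreducible_rep G n \<rho> \<and> pointwise_stab G \<rho> (fixed_space n \<rho> H) = H"
proof -
  interpret group G by fact
  note fin = assms(2) and H = assms(3)
  have Hc: "H \<subseteq> carrier G" using H subgroup.subset by blast
  obtain I :: "nat set" and \<phi> where I: "finite I"
    and bij: "bij_betw \<phi> (Pow I) (sg_bottom_interval G H)"
    and emb: "\<forall>S\<in>Pow I. \<forall>T\<in>Pow I. S \<subseteq> T \<longleftrightarrow> \<phi> S \<subseteq> \<phi> T"
    using assms(4) unfolding bottom_boolean_def boolean_lattice_def by (elim exE conjE)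
  have ord: "S \<subseteq> T \<longleftrightarrow> \<phi> S \<subseteq> \<phi> T" if "S \<subseteq> I" "T \<subseteq> I" for S T
    using bspec[OF bspec[OF emb]] that by simp
  have \<phi>: "\<phi> S \<in> sg_bottom_interval G H" if "S \<subseteq> I" for S
    using bij that unfolding bij_betw_def by blast
  then have \<phi>_sub: "subgroup (\<phi> S) G \<and> H \<subseteq> \<phi> S" if "S \<subseteq> I" for S
    using that unfolding sg_bottom_interval_def sg_interval_def by blast
  have mono: "\<phi> S \<subseteq> \<phi> T" if "S \<subseteq> T" "T \<subseteq> I" for S T
    using ord[of S T] that by (meson order_trans)
  have notle: "\<not> \<phi> {i} \<subseteq> \<phi> S" if "S \<subseteq> I" "i \<in> I" "i \<notin> S" for S i
    using ord[of "{i}" S] that by simp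
  obtain x where x: "\<exists>g\<in>carrier G. x g \<noteq> 0"
    and ann: "\<And>i \<chi>. i \<in> I \<Longrightarrow> class_function G \<chi> \<Longrightarrow> absorbs G H (\<phi> {i}) \<chi> \<Longrightarrow> annihilates G x \<chi>"
    using ex_annihilating_element[where K = \<phi>, OF fin H I \<phi>_sub mono notle] by blast
  obtain y where y1: "y \<one>\<^bsub>G\<^esub> \<noteq> 0"
    and y: "\<And>\<chi>. annihilates G x \<chi> \<Longrightarrow> (\<Sum>g\<in>carrier G. y g * \<chi> g) = 0"
    using ex_annihilating_coefficients[OF fin x] by blast
  obtain n \<rho> where irr: "irreducible_rep G n \<rho>"
    and nz: "(\<Sum>g\<in>carrier G. y g * mat_trace (\<rho> g)) \<noteq> 0"
    using ex_irreducible_rep_trace[where y = y, OF \<open>group G\<close> fin y1] by blast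
  have \<rho>: "is_rep G n \<rho>" using irr unfolding irreducible_rep_def by blast
  let ?L = "pointwise_stab G \<rho> (fixed_space n \<rho> H)"
  have L: "subgroup ?L G"
    by (rule subgroup_pointwise_stab[OF \<open>group G\<close> \<rho>]) (auto simp: fixed_space_def)
  have HL: "H \<subseteq> ?L" using Hc unfolding pointwise_stab_def fixed_space_def by auto
  have "?L = H"
  proof (rule ccontr)
    assume "?L \<noteq> H"
    then obtain A where A: "A \<in> sg_atoms G H" "A \<subseteq> ?L"
      using ex_atom_le[OF fin L, of H] HL by blast
    \<comment> \<open>Atoms and \<open>H\<close> itself lie in the bottom interval, so both are
      values of \<open>\<phi>\<close>.\<close>
    have "A \<subseteq> sg_bottom_top G H"
      using A(1) generate.incl[of _ "H \<union> \<Union> (sg_atoms G H)" G] unfolding sg_bottom_top_def by blast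
    then have "A \<in> sg_bottom_interval G H"
      using A(1) unfolding sg_bottom_interval_def sg_atoms_def by blast
    then obtain T where T: "T \<subseteq> I" "A = \<phi> T" using bij unfolding bij_betw_def by blast
    have "H \<in> sg_bottom_interval G H"
      using H generate.incl[of _ "H \<union> \<Union> (sg_atoms G H)" G]
      unfolding sg_bottom_interval_def sg_bottom_top_def sg_interval_def by blast
    then obtain T0 where T0: "T0 \<subseteq> I" "H = \<phi> T0" using bij unfolding bij_betw_def by blast
    \<comment> \<open>Since \<open>\<phi> {}\<close> is the least element, an empty \<open>T\<close>
      would put the atom inside \<open>H\<close>. For any \<open>i\<close> in \<open>T\<close>,
      monotonicity places \<open>\<phi> {i}\<close> below \<open>A\<close> and hence in the
      stabiliser, which is enough to apply \<open>ann\<close>.\<close>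
    have "T \<noteq> {}"
    proof
      assume "T = {}"
      then have "A \<subseteq> H" using ord[of "{}" T0] T T0 by auto
      then show False using A(1) unfolding sg_atoms_def by blast
    qed
    then obtain i where i: "i \<in> T" by blast
    then have "\<phi> {i} \<subseteq> ?L" using ord[of "{i}" T] T A(2) by auto
    then have "absorbs G H (\<phi> {i}) (\<lambda>g. mat_trace (\<rho> g))"
      by (rule fixed_space_absorbs[OF \<open>group G\<close> H _ \<rho>])
    then have "annihilates G x (\<lambda>g. mat_trace (\<rho> g))"
      using ann class_function_trace[OF \<rho>] i T by blast
    then show False using y nz by blast
  qed
  then show ?thesis using irr by blast
qed

end
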